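(* Lock elision is unsound in ARMv8 extended with transactions. That is, there exist a well-formed lock-extended ARMv8 execution $X$, a well-formed ARMv8 transactional execution $Y$, and an ARMv8 lock-elision mapping $\pi$ from the events of $X$ to the events of $Y$ (all as defined in the context), such that $X$ violates the axiom CROrder while $Y$ is consistent in the transactional ARMv8 memory model. Specifically, the following is such a triple. $X$ has two threads, with events in program order $a_1\in L,\ a_2\in R,\ a_3\in W,\ a_4\in U$ and $b_1\in L^{\rm t},\ b_2\in W,\ b_3\in U^{\rm t}$; the events $a_2,a_3,b_2$ access one location $x$; $\mathit{data}=\{(a_2,a_3)\}$, $\mathit{co}=\{(b_2,a_3)\}$, $\mathit{rf}=\emptyset$; the other dependency relations, $\mathit{rmw}$ and $\mathit{stxn}$ are empty. $Y$ has two threads, with events in program order $c_1\in R\cap\mathit{Acq},\ c_2\in W,\ c_3\in R,\ c_4\in W,\ c_5\in W\cap\mathit{Rel}$ and $d_1\in R,\ d_2\in W$, where $c_1,c_2,c_5,d_1$ access a location $m$ and $c_3,c_4,d_2$ access a location $x\neq m$; $\mathit{rmw}=\mathit{ctrl}=\{(c_1,c_2)\}$, $\mathit{data}=\{(c_3,c_4)\}$, $\mathit{addr}=\emptyset$, $\mathit{rf}=\emptyset$, $\mathit{co}=\{(d_2,c_4),(c_2,c_5)\}$, $\mathit{stxn}=\{d_1,d_2\}^2$, no fences and no other acquire/release events. $\pi=\{(a_1,c_1),(a_1,c_2),(a_2,c_3),(a_3,c_4),(a_4,c_5),(b_1,d_1),(b_2,d_2)\}$.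
   Context: **Notation.** For binary relations on a set of events $E$: $r^{-1}$, $r^?$, $r^+$, $r^*$ are inverse, reflexive closure, transitive closure, reflexive-transitive closure; $\neg$ is complement; $r_1;r_2$ is relational composition (left to right); $[s]=\{(x,x)\mid x\in s\}$; $r$ is acyclic iff $r^+$ is irreflexive. $r_{\rm e}=r\setminus(\mathit{po}\cup\mathit{po}^{-1})^*$, $r_{\rm i}=r\cap(\mathit{po}\cup\mathit{po}^{-1})^*$, $r_{\rm loc}=r\cap\mathit{sloc}$. $\mathsf{weaklift}(r,t)=t;(r\setminus t);t$ and $\mathsf{stronglift}(r,t)=t^?;(r\setminus t);t^?$. **Executions.** An execution is a finite set $E$ of events, partitioned into reads $R$, writes $W$, fences $F$, with relations satisfying: $\mathit{po}$ is, for each thread, a strict total order on that thread's events (relating only events of the same thread); dependencies $\mathit{addr},\mathit{ctrl},\mathit{data}\subseteq\mathit{po}$ originate at reads; $\mathit{sloc}$ is an equivalence relation on $R\cup W$ (same location); $\mathit{rmw}\subseteq\mathit{po}_{\rm loc}$ links the read of a read-modify-write to its write; $\mathit{rf}$ goes from writes to reads of the same location, each read having at most one incoming edge (a read with none reads the initial value); $\mathit{co}$ relates writes to the same location and is, per location, a strict total order; $\mathit{stxn}$ (same successful transaction) is a partial equivalence relation whose classes are contiguous subsets of $\mathit{po}$. $\mathit{fr}=([R];\mathit{sloc};[W])\setminus(\mathit{rf}^{-1};(\mathit{co}^{-1})^* )$, $\mathit{com}=\mathit{rf}\cup\mathit{co}\cup\mathit{fr}$. ARMv8 executions also have sets $\mathit{Acq}\subseteq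 R$, $\mathit{Rel}\subseteq W$, a set $\mathit{ISB}\subseteq F$ of ISB fences, and relations $\mathit{dmb},\mathit{dmbld},\mathit{dmbst}$ relating events in program order separated by a DMB, DMB LD, DMB ST fence event respectively. **Transactional ARMv8 consistency.** With - $\mathit{dob}=\mathit{addr}\cup\mathit{data}\cup(\mathit{ctrl};[W])\cup((\mathit{ctrl}\cup(\mathit{addr};\mathit{po}));[\mathit{ISB}];\mathit{po};[R])\cup(\mathit{addr};\mathit{po};[W])\cup((\mathit{ctrl}\cup\mathit{data});\mathit{co}_{\rm i})\cup((\mathit{addr}\cup\mathit{data});\mathit{rf}_{\rm i})$ - $\mathit{aob}=\mathit{rmw}\cup([\mathrm{range}(\mathit{rmw})];\mathit{rf}_{\rm i};[\mathit{Acq}])$ - $\mathit{bob}=\mathit{dmb}\cup([\mathit{Rel}];\mathit{po};[\mathit{Acq}])\cup([R];\mathit{dmbld})\cup([\mathit{Acq}];\mathit{po})\cup([W];\mathit{dmbst};[W])\cup(\mathit{po};[\mathit{Rel}])\cup(\mathit{po};[\mathit{Rel}];\mathit{co}_{\rm i})$ - $\mathit{tfence}=\mathit{po}\cap((\neg\mathit{stxn};\mathit{stxn})\cup(\mathit{stxn};\neg\mathit{stxn}))$ - $\mathit{ob}=\mathit{com}_{\rm e}\cup\mathit{dob}\cup\mathit{aob}\cup\mathit{bob}\cup\mathit{tfence}$ an execution is consistent iff: $\mathit{po}_{\rm loc}\cup\mathit{com}$ is acyclic (Coherence); $\mathit{ob}$ is acyclic (Order); $\mathit{rmw}\cap(\mathit{fr}_{\rm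 e};\mathit{co}_{\rm e})=\emptyset$ (RMWIsol); $\mathsf{stronglift}(\mathit{com},\mathit{stxn})$ is acyclic (StrongIsol); $\mathsf{stronglift}(\mathit{ob},\mathit{stxn})$ is acyclic (TxnOrder); $\mathit{rmw}\cap\mathit{tfence}^*=\emptyset$ (TxnCancelsRMW). **Lock-extended executions** have four further event types (disjoint from $R,W,F$): $L$ and $U$ (lock()/unlock() calls implemented by ordinary acquisition/release of the lock) and $L^{\rm t}$, $U^{\rm t}$ (lock()/unlock() calls to be transactionalised). Well-formedness requires that in each thread every $L$ is followed by a matching $U$, and every $L^{\rm t}$ by a matching $U^{\rm t}$, with no other lock/unlock event in between (and every unlock event is so matched). A critical region consists of a matching lock/unlock pair and all events between them in $\mathit{po}$. $\mathit{scr}$ is the relation between events of the same critical region, and $\mathit{scr}^{\rm t}\subseteq\mathit{scr}$ its restriction to critical regions delimited by $L^{\rm t},U^{\rm t}$. The specification of locks is the axiom CROrder: $\mathsf{weaklift}(\mathit{po}\cup\mathit{com},\mathit{scr})$ is acyclic. **ARMv8 lock-elision mapping.** A relation $\pi$ from events of $X$ (lock-extended) to events of $Y$ such that every event of $Y$ is the image of exactly one event of $X$ and: - each event of $X$ that is not a lock/unlock event maps to exactly one event, of the same type, and $\pi$ preserves and reflects all execution structure ($\mathit{po}$, dependencies, $\mathit{rmw}$, $\mathit{rf}$, $\mathit{co}$) among such events; $\pi$ also preserves program order: if $(e,e')\in\mathit{po}_X$ then all images of $e$ are $\mathit{po}_Y$-before all images of $e'$; - each $L$ event maps to a pair consisting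 of an acquire read and a write, with an $\mathit{rmw}$ edge and a $\mathit{ctrl}$ edge (hence $\mathit{po}$) from the read to the write; each $U$ event maps to one release write; each $L^{\rm t}$ event maps to one (plain) read; $U^{\rm t}$ events have no image; - (LockVar) with $I=\pi(L\cup U\cup L^{\rm t}\cup U^{\rm t})$: $\mathit{sloc}_Y=I^2\cup((\neg I)^2\cap(\pi^{-1};\mathit{sloc}_X;\pi))$; - (TxnIntro) $\mathit{scr}^{\rm t}\cap(\neg U^{\rm t})^2=\pi;\mathit{stxn}_Y;\pi^{-1}$; - (TxnReadsLockFree) $[L];\pi;\mathit{rf}_Y;\pi^{-1};[L^{\rm t}]=\emptyset$. *)

theory Defs
  imports Main
begin

section \<open>Transactional ARMv8 executions\<close>

text \<open>Barriers are fence events; the relations \<open>dmb\<close>, \<open>dmbld\<close>, \<open>dmbst\<close> of the memory model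
  are derived from the sets \<open>DMB\<close>, \<open>DMBLD\<close>, \<open>DMBST\<close> below.
  Threads are given by the labelling \<open>thread\<close>; only its values on \<open>events\<close> matter.\<close>

record 'e arm_exec =
  events :: "'e set"
  reads :: "'e set"
  writes :: "'e set"
  fences :: "'e set"
  thread :: "'e \<Rightarrow> nat"
  po :: "'e rel"
  addr :: "'e rel"
  ctrl :: "'e rel"
  data :: "'e rel"
  sloc :: "'e rel"
  rmw :: "'e rel"
  rf :: "'e rel"
  co :: "'e rel"
  stxn :: "'e rel"
  Acq :: "'e set"
  Rel :: "'e set"
  ISB :: "'e set"
  DMB :: "'e set"
  DMBLD :: "'e set"
  DMBST :: "'e set"

text \<open>A list of blocks rather than a set of blocks, so that a nonempty block
  occurring twice is ruled out; blocks may be empty.\<close>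

definition partitioned_into :: "'e set \<Rightarrow> 'e set list \<Rightarrow> bool" where
  "partitioned_into A Bs \<longleftrightarrow> A = \<Union>(set Bs) \<and> sorted_wrt disjnt Bs"

text \<open>The well-formedness conditions shared by ordinary and lock-extended executions,
  i.e. all except the partition of the events into kinds.\<close>

definition wf_structure :: "('e, 'm) arm_exec_scheme \<Rightarrow> bool" where
  "wf_structure X \<longleftrightarrow>
     finite (events X) \<and>
     po X \<subseteq> {(x, y). x \<in> events X \<and> y \<in> events X \<and> thread X x = thread X y} \<and>
     irrefl (po X) \<and> trans (po X) \<and>
     (\<forall>t. total_on {x \<in> events X. thread X x = t} (po X)) \<and>
     addr X \<union> ctrl X \<union> data X \<subseteq> Id_on (reads X) O po X \<and>
     equiv (reads X \<union> writes X) (sloc X) \<and>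
     rmw X \<subseteq> (po X \<inter> sloc X) \<inter> (reads X \<times> writes X) \<and>
     single_valued (rmw X) \<and> single_valued ((rmw X)^-1) \<and>
     rf X \<subseteq> sloc X \<inter> (writes X \<times> reads X) \<and> single_valued ((rf X)^-1) \<and>
     co X \<subseteq> sloc X \<inter> (writes X \<times> writes X) \<and> irrefl (co X) \<and> trans (co X) \<and>
     (\<forall>w \<in> writes X. total_on (writes X \<inter> sloc X `` {w}) (co X)) \<and>
     \<comment> \<open>a partial equivalence whose classes are contiguous in program order\<close>
     stxn X \<subseteq> events X \<times> events X \<and> sym (stxn X) \<and> trans (stxn X) \<and>
     stxn X \<subseteq> (po X \<union> (po X)^-1)^= \<and>
     (\<forall>x y z. (x, z) \<in> stxn X \<and> (x, y) \<in> po X \<and> (y, z) \<in> po X \<longrightarrow> (x, y) \<in> stxn X) \<and>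
     Acq X \<subseteq> reads X \<and> Rel X \<subseteq> writes X \<and>
     ISB X \<union> DMB X \<union> DMBLD X \<union> DMBST X \<subseteq> fences X"

definition wf_arm_exec :: "'e arm_exec \<Rightarrow> bool" where
  "wf_arm_exec Y \<longleftrightarrow>
     wf_structure Y \<and> partitioned_into (events Y) [reads Y, writes Y, fences Y]"

section \<open>Derived relations\<close>

definition weaklift :: "'e rel \<Rightarrow> 'e rel \<Rightarrow> 'e rel" where
  "weaklift r t = t O (r - t) O t"

definition stronglift :: "'e rel \<Rightarrow> 'e rel \<Rightarrow> 'e rel" where
  "stronglift r t = t^= O (r - t) O t^="

definition external :: "('e, 'm) arm_exec_scheme \<Rightarrow> 'e rel \<Rightarrow> 'e rel" where
  "external X r = r - (po X \<union> (po X)^-1)^*"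

definition internal :: "('e, 'm) arm_exec_scheme \<Rightarrow> 'e rel \<Rightarrow> 'e rel" where
  "internal X r = r \<inter> (po X \<union> (po X)^-1)^*"

definition fr :: "('e, 'm) arm_exec_scheme \<Rightarrow> 'e rel" where
  "fr X = (Id_on (reads X) O sloc X O Id_on (writes X)) - ((rf X)^-1 O ((co X)^-1)^*)"

definition com :: "('e, 'm) arm_exec_scheme \<Rightarrow> 'e rel" where
  "com X = rf X \<union> co X \<union> fr X"

definition dmb :: "('e, 'm) arm_exec_scheme \<Rightarrow> 'e rel" where
  "dmb X = po X O Id_on (DMB X) O po X"

definition dmbld :: "('e, 'm) arm_exec_scheme \<Rightarrow> 'e rel" where
  "dmbld X = po X O Id_on (DMBLD X) O po X"

definition dmbst :: "('e, 'm) arm_exec_scheme \<Rightarrow> 'e rel" where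
  "dmbst X = po X O Id_on (DMBST X) O po X"

section \<open>Transactional ARMv8 consistency\<close>

definition dob :: "('e, 'm) arm_exec_scheme \<Rightarrow> 'e rel" where
  "dob X =
     addr X \<union> data X \<union>
     (ctrl X O Id_on (writes X)) \<union>
     ((ctrl X \<union> (addr X O po X)) O Id_on (ISB X) O po X O Id_on (reads X)) \<union>
     (addr X O po X O Id_on (writes X)) \<union>
     ((ctrl X \<union> data X) O internal X (co X)) \<union>
     ((addr X \<union> data X) O internal X (rf X))"

definition aob :: "('e, 'm) arm_exec_scheme \<Rightarrow> 'e rel" where
  "aob X = rmw X \<union> (Id_on (Range (rmw X)) O internal X (rf X) O Id_on (Acq X))"

definition bob :: "('e, 'm) arm_exec_scheme \<Rightarrow> 'e rel" where
  "bob X =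
     dmb X \<union>
     (Id_on (Rel X) O po X O Id_on (Acq X)) \<union>
     (Id_on (reads X) O dmbld X) \<union>
     (Id_on (Acq X) O po X) \<union>
     (Id_on (writes X) O dmbst X O Id_on (writes X)) \<union>
     (po X O Id_on (Rel X)) \<union>
     (po X O Id_on (Rel X) O internal X (co X))"

text \<open>Complements (here and in the mapping below) are taken in the whole type; they are always
  intersected with a relation on the events, so this makes no difference.\<close>

definition tfence :: "('e, 'm) arm_exec_scheme \<Rightarrow> 'e rel" where
  "tfence X = po X \<inter> (((- stxn X) O stxn X) \<union> (stxn X O (- stxn X)))"

definition ob :: "('e, 'm) arm_exec_scheme \<Rightarrow> 'e rel" where
  "ob X = external X (com X) \<union> dob X \<union> aob X \<union> bob X \<union> tfence X"

definition Coherence :: "('e, 'm) arm_exec_scheme \<Rightarrow> bool" where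
  "Coherence X \<longleftrightarrow> acyclic ((po X \<inter> sloc X) \<union> com X)"

definition Order :: "('e, 'm) arm_exec_scheme \<Rightarrow> bool" where
  "Order X \<longleftrightarrow> acyclic (ob X)"

definition RMWIsol :: "('e, 'm) arm_exec_scheme \<Rightarrow> bool" where
  "RMWIsol X \<longleftrightarrow> rmw X \<inter> (external X (fr X) O external X (co X)) = {}"

definition StrongIsol :: "('e, 'm) arm_exec_scheme \<Rightarrow> bool" where
  "StrongIsol X \<longleftrightarrow> acyclic (stronglift (com X) (stxn X))"

definition TxnOrder :: "('e, 'm) arm_exec_scheme \<Rightarrow> bool" where
  "TxnOrder X \<longleftrightarrow> acyclic (stronglift (ob X) (stxn X))"

definition TxnCancelsRMW :: "('e, 'm) arm_exec_scheme \<Rightarrow> bool" where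
  "TxnCancelsRMW X \<longleftrightarrow> rmw X \<inter> (tfence X)^* = {}"

definition arm_consistent :: "'e arm_exec \<Rightarrow> bool" where
  "arm_consistent Y \<longleftrightarrow>
     Coherence Y \<and> Order Y \<and> RMWIsol Y \<and> StrongIsol Y \<and> TxnOrder Y \<and> TxnCancelsRMW Y"

section \<open>Lock-extended executions\<close>

text \<open>\<open>Lt\<close> and \<open>Ut\<close> are the lock and unlock calls that are to be transactionalised.\<close>

record 'e lock_exec = "'e arm_exec" +
  Lk :: "'e set"
  Ul :: "'e set"
  Lt :: "'e set"
  Ut :: "'e set"

definition lock_events :: "'e lock_exec \<Rightarrow> 'e set" where
  "lock_events X = Lk X \<union> Ul X \<union> Lt X \<union> Ut X"

definition adjacent :: "'e lock_exec \<Rightarrow> 'e \<Rightarrow> 'e \<Rightarrow> bool" where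
  "adjacent X l u \<longleftrightarrow>
     (l, u) \<in> po X \<and> \<not> (\<exists>z \<in> lock_events X. (l, z) \<in> po X \<and> (z, u) \<in> po X)"

definition matching :: "'e lock_exec \<Rightarrow> 'e rel" where
  "matching X = {(l, u). l \<in> Lk X \<and> u \<in> Ul X \<and> adjacent X l u}"

definition matching_t :: "'e lock_exec \<Rightarrow> 'e rel" where
  "matching_t X = {(l, u). l \<in> Lt X \<and> u \<in> Ut X \<and> adjacent X l u}"

definition wf_lock_exec :: "'e lock_exec \<Rightarrow> bool" where
  "wf_lock_exec X \<longleftrightarrow>
     wf_structure X \<and>
     partitioned_into (events X) [reads X, writes X, fences X, Lk X, Ul X, Lt X, Ut X] \<and>
     (\<forall>l \<in> Lk X. \<exists>u. (l, u) \<in> matching X) \<and> (\<forall>u \<in> Ul X. \<exists>l. (l, u) \<in> matching X) \<and>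
     (\<forall>l \<in> Lt X. \<exists>u. (l, u) \<in> matching_t X) \<and> (\<forall>u \<in> Ut X. \<exists>l. (l, u) \<in> matching_t X)"

definition region :: "'e lock_exec \<Rightarrow> 'e \<Rightarrow> 'e \<Rightarrow> 'e set" where
  "region X l u = {l, u} \<union> {z. (l, z) \<in> po X \<and> (z, u) \<in> po X}"

definition scr :: "'e lock_exec \<Rightarrow> 'e rel" where
  "scr X = (\<Union>(l, u) \<in> matching X \<union> matching_t X. region X l u \<times> region X l u)"

definition scr_t :: "'e lock_exec \<Rightarrow> 'e rel" where
  "scr_t X = (\<Union>(l, u) \<in> matching_t X. region X l u \<times> region X l u)"

definition CROrder :: "'e lock_exec \<Rightarrow> bool" where
  "CROrder X \<longleftrightarrow> acyclic (weaklift (po X \<union> com X) (scr X))"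

section \<open>The ARMv8 lock-elision mapping\<close>

definition same_type :: "'e lock_exec \<Rightarrow> 'f arm_exec \<Rightarrow> 'e \<Rightarrow> 'f \<Rightarrow> bool" where
  "same_type X Y e f \<longleftrightarrow>
     (e \<in> reads X \<longleftrightarrow> f \<in> reads Y) \<and> (e \<in> writes X \<longleftrightarrow> f \<in> writes Y) \<and>
     (e \<in> fences X \<longleftrightarrow> f \<in> fences Y) \<and>
     (e \<in> Acq X \<longleftrightarrow> f \<in> Acq Y) \<and> (e \<in> Rel X \<longleftrightarrow> f \<in> Rel Y) \<and>
     (e \<in> ISB X \<longleftrightarrow> f \<in> ISB Y) \<and> (e \<in> DMB X \<longleftrightarrow> f \<in> DMB Y) \<and>
     (e \<in> DMBLD X \<longleftrightarrow> f \<in> DMBLD Y) \<and> (e \<in> DMBST X \<longleftrightarrow> f \<in> DMBST Y)"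

definition preserves_reflects_on ::
    "'e set \<Rightarrow> ('e \<times> 'f) set \<Rightarrow> 'e rel \<Rightarrow> 'f rel \<Rightarrow> bool" where
  "preserves_reflects_on A \<pi> r s \<longleftrightarrow>
     (\<forall>e \<in> A. \<forall>e' \<in> A. \<forall>f f'. (e, f) \<in> \<pi> \<and> (e', f') \<in> \<pi> \<longrightarrow>
        ((e, e') \<in> r \<longleftrightarrow> (f, f') \<in> s))"

definition elision_events :: "'e lock_exec \<Rightarrow> 'f arm_exec \<Rightarrow> ('e \<times> 'f) set \<Rightarrow> bool" where
  "elision_events X Y \<pi> \<longleftrightarrow>
     (\<forall>e \<in> events X - lock_events X. \<exists>f. \<pi> `` {e} = {f} \<and> same_type X Y e f) \<and>
     (\<forall>e \<in> Lk X. \<exists>r w. \<pi> `` {e} = {r, w} \<and> r \<in> reads Y \<inter> Acq Y \<and> w \<in> writes Y \<and>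
        (r, w) \<in> rmw Y \<and> (r, w) \<in> ctrl Y) \<and>
     (\<forall>e \<in> Ul X. \<exists>w. \<pi> `` {e} = {w} \<and> w \<in> writes Y \<inter> Rel Y) \<and>
     (\<forall>e \<in> Lt X. \<exists>r. \<pi> `` {e} = {r} \<and> r \<in> reads Y - Acq Y) \<and>
     (\<forall>e \<in> Ut X. \<pi> `` {e} = {})"

definition elision_structure :: "'e lock_exec \<Rightarrow> 'f arm_exec \<Rightarrow> ('e \<times> 'f) set \<Rightarrow> bool" where
  "elision_structure X Y \<pi> \<longleftrightarrow>
     (let A = events X - lock_events X in
        preserves_reflects_on A \<pi> (po X) (po Y) \<and>
        preserves_reflects_on A \<pi> (addr X) (addr Y) \<and>
        preserves_reflects_on A \<pi> (ctrl X) (ctrl Y) \<and>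
        preserves_reflects_on A \<pi> (data X) (data Y) \<and>
        preserves_reflects_on A \<pi> (rmw X) (rmw Y) \<and>
        preserves_reflects_on A \<pi> (rf X) (rf Y) \<and>
        preserves_reflects_on A \<pi> (co X) (co Y)) \<and>
     (\<forall>(e, e') \<in> po X. \<forall>f f'. (e, f) \<in> \<pi> \<and> (e', f') \<in> \<pi> \<longrightarrow> (f, f') \<in> po Y)"

definition LockVar :: "'e lock_exec \<Rightarrow> 'f arm_exec \<Rightarrow> ('e \<times> 'f) set \<Rightarrow> bool" where
  "LockVar X Y \<pi> \<longleftrightarrow>
     (let I = \<pi> `` lock_events X in
        sloc Y = (I \<times> I) \<union> (((- I) \<times> (- I)) \<inter> (\<pi>^-1 O sloc X O \<pi>)))"

definition TxnIntro :: "'e lock_exec \<Rightarrow> 'f arm_exec \<Rightarrow> ('e \<times> 'f) set \<Rightarrow> bool" where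
  "TxnIntro X Y \<pi> \<longleftrightarrow> scr_t X \<inter> ((- Ut X) \<times> (- Ut X)) = \<pi> O stxn Y O \<pi>^-1"

definition TxnReadsLockFree :: "'e lock_exec \<Rightarrow> 'f arm_exec \<Rightarrow> ('e \<times> 'f) set \<Rightarrow> bool" where
  "TxnReadsLockFree X Y \<pi> \<longleftrightarrow> Id_on (Lk X) O \<pi> O rf Y O \<pi>^-1 O Id_on (Lt X) = {}"

definition elision_mapping :: "'e lock_exec \<Rightarrow> 'f arm_exec \<Rightarrow> ('e \<times> 'f) set \<Rightarrow> bool" where
  "elision_mapping X Y \<pi> \<longleftrightarrow>
     \<pi> \<subseteq> events X \<times> events Y \<and> (\<forall>f \<in> events Y. \<exists>!e. (e, f) \<in> \<pi>) \<and>
     elision_events X Y \<pi> \<and> elision_structure X Y \<pi> \<and>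
     LockVar X Y \<pi> \<and> TxnIntro X Y \<pi> \<and> TxnReadsLockFree X Y \<pi>"

section \<open>The concrete triple\<close>

text \<open>\<open>Ea i\<close>, \<open>Eb i\<close>, \<open>Ec i\<close>, \<open>Ed i\<close> are the events $a_i$, $b_i$, $c_i$, $d_i$.
  The type is infinite, so it can carry every finite execution up to renaming of events.\<close>

datatype event = Ea nat | Eb nat | Ec nat | Ed nat

fun event_thread :: "event \<Rightarrow> nat" where
  "event_thread (Ea i) = 0"
| "event_thread (Eb i) = 1"
| "event_thread (Ec i) = 0"
| "event_thread (Ed i) = 1"

text \<open>The strict total order in which the members of a (distinct) list are listed.\<close>

fun list_order :: "'a list \<Rightarrow> 'a rel" where
  "list_order [] = {}"
| "list_order (x # xs) = ({x} \<times> set xs) \<union> list_order xs"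

definition X_ex :: "event lock_exec" where
  "X_ex = \<lparr>
     events = {Ea 1, Ea 2, Ea 3, Ea 4, Eb 1, Eb 2, Eb 3},
     reads = {Ea 2},
     writes = {Ea 3, Eb 2},
     fences = {},
     thread = event_thread,
     po = list_order [Ea 1, Ea 2, Ea 3, Ea 4] \<union> list_order [Eb 1, Eb 2, Eb 3],
     addr = {},
     ctrl = {},
     data = {(Ea 2, Ea 3)},
     sloc = {Ea 2, Ea 3, Eb 2} \<times> {Ea 2, Ea 3, Eb 2},
     rmw = {},
     rf = {},
     co = {(Eb 2, Ea 3)},
     stxn = {},
     Acq = {}, Rel = {}, ISB = {}, DMB = {}, DMBLD = {}, DMBST = {},
     Lk = {Ea 1}, Ul = {Ea 4}, Lt = {Eb 1}, Ut = {Eb 3} \<rparr>"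

definition Y_ex :: "event arm_exec" where
  "Y_ex = \<lparr>
     events = {Ec 1, Ec 2, Ec 3, Ec 4, Ec 5, Ed 1, Ed 2},
     reads = {Ec 1, Ec 3, Ed 1},
     writes = {Ec 2, Ec 4, Ec 5, Ed 2},
     fences = {},
     thread = event_thread,
     po = list_order [Ec 1, Ec 2, Ec 3, Ec 4, Ec 5] \<union> list_order [Ed 1, Ed 2],
     addr = {},
     ctrl = {(Ec 1, Ec 2)},
     data = {(Ec 3, Ec 4)},
     sloc = ({Ec 1, Ec 2, Ec 5, Ed 1} \<times> {Ec 1, Ec 2, Ec 5, Ed 1}) \<union>
            ({Ec 3, Ec 4, Ed 2} \<times> {Ec 3, Ec 4, Ed 2}),
     rmw = {(Ec 1, Ec 2)},
     rf = {},
     co = {(Ed 2, Ec 4), (Ec 2, Ec 5)},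
     stxn = {Ed 1, Ed 2} \<times> {Ed 1, Ed 2},
     Acq = {Ec 1}, Rel = {Ec 5}, ISB = {}, DMB = {}, DMBLD = {}, DMBST = {} \<rparr>"

definition pi_ex :: "(event \<times> event) set" where
  "pi_ex = {(Ea 1, Ec 1), (Ea 1, Ec 2), (Ea 2, Ec 3), (Ea 3, Ec 4), (Ea 4, Ec 5),
            (Eb 1, Ed 1), (Eb 2, Ed 2)}"

end

(* In Y the transaction d1 d2 serialises between the read c3 and the write c4 of the critical
   region. Nothing prevents this: the acquire/release accesses order c1 and c5, but c3 is not ordered
   after the lock-acquiring write c2, so the transaction may read the lock variable before c2.
   One numbering of the events, strictly increasing along both coherence and ob and constant on
   the transaction, therefore witnesses all the acyclicity axioms at once. In X, on the other hand,
   fr (a2, b2) and co (b2, a3) put each critical region before the other. *)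

theory Submission
  imports Defs
begin

declare One_nat_def [simp del] \<comment> \<open>keeps the event indices in numeral form\<close>

section \<open>Acyclicity from rank functions\<close>

lemma acyclic_rank:
  fixes f :: "'a \<Rightarrow> nat"
  assumes "r \<subseteq> {(x, y). f x < f y}"
  shows "acyclic r"
proof -
  have "r \<subseteq> measure f"
    using assms by auto
  then show ?thesis
    by (meson acyclic_subset wf_acyclic wf_measure)
qed

text \<open>The \<open>t\<close> steps at either end of a lifted edge keep \<open>f\<close> fixed
  and the \<open>r\<close> step in the middle raises it, so every lifted edge raises
  \<open>f\<close>.\<close>

lemma acyclic_stronglift_rank:
  fixes f :: "'a \<Rightarrow> nat"
  assumes "r \<subseteq> {(x, y). f x < f y}" and "t \<subseteq> {(x, y). f x = f y}"
  shows "acyclic (stronglift r t)"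
proof (rule acyclic_rank)
  have t: "f x = f y" if "(x, y) \<in> t^=" for x y
    using that assms(2) by auto
  have r: "f x < f y" if "(x, y) \<in> r" for x y
    using that assms(1) by auto
  show "stronglift r t \<subseteq> {(x, y). f x < f y}"
  proof clarify
    fix x y
    assume "(x, y) \<in> stronglift r t"
    then obtain u v where "(x, u) \<in> t^=" "(u, v) \<in> r" "(v, y) \<in> t^="
      unfolding stronglift_def by blast
    then show "f x < f y"
      using t r by metis
  qed
qed

text \<open>Transports a block of \<open>sloc\<close> or \<open>stxn\<close> along the mapping, as
  \<open>LockVar\<close> and \<open>TxnIntro\<close> require.\<close>

lemma relcomp_Times_Image: "r^-1 O (A \<times> B) O s = (r `` A) \<times> (s `` B)"
  by blast

lemma external_subset: "external X r \<subseteq> r"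
  and internal_subset: "internal X r \<subseteq> r"
  by (auto simp: external_def internal_def)

text \<open>The serialisation \<open>Ec 1\<close>, \<open>Ec 3\<close>, transaction,
  \<open>Ec 2\<close>, \<open>Ec 4\<close>, \<open>Ec 5\<close>: the shift \<open>i + 1\<close>
  leaves 2 free for both \<open>Ed\<close> events, and \<open>Ec 3\<close> overtakes
  \<open>Ec 2\<close>.\<close>

fun rank :: "event \<Rightarrow> nat" where
  "rank (Ec i) = (if i = 1 then 0 else if i = 3 then 1 else i + 1)"
| "rank _ = 2"

lemma com_X_ex:
  "com X_ex = {(Eb 2, Ea 3), (Ea 2, Ea 3), (Ea 2, Eb 2)}"
  by (auto simp: com_def fr_def X_ex_def)

lemma fr_Y_ex:
  "fr Y_ex = {(Ec 1, Ec 2), (Ec 1, Ec 5), (Ed 1, Ec 2), (Ed 1, Ec 5), (Ec 3, Ec 4), (Ec 3, Ed 2)}"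
proof -
  have "rf Y_ex = {}"
    by (simp add: Y_ex_def)
  \<comment> \<open>All reads see the initial value, so nothing is subtracted in
    \<open>fr\<close>.\<close>
  then have "fr Y_ex = sloc Y_ex \<inter> (reads Y_ex \<times> writes Y_ex)"
    by (auto simp: fr_def)
  also have "\<dots> = {Ec 1, Ed 1} \<times> {Ec 2, Ec 5} \<union> {Ec 3} \<times> {Ec 4, Ed 2}"
    by (simp add: Y_ex_def Int_Un_distrib2 Times_Int_Times) blast
  finally show ?thesis
    by auto
qed

lemma com_Y_ex_rank: "com Y_ex \<subseteq> {(x, y). rank x < rank y}"
  unfolding com_def fr_Y_ex by (auto simp: Y_ex_def)

text \<open>The transaction fills its whole thread, so no program-order edge crosses its
  boundary.\<close>

lemma tfence_Y_ex: "tfence Y_ex = {}"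
  by (auto simp: tfence_def Y_ex_def)

lemma dob_Y_ex_rank: "dob Y_ex \<subseteq> {(x, y). rank x < rank y}"
proof -
  \<comment> \<open>Since \<open>addr\<close>, \<open>ISB\<close> and \<open>rf\<close> are empty,
    only these clauses survive; \<open>co\<close> may replace its internal part because all of
    \<open>co\<close> raises the rank.\<close>
  have "dob Y_ex \<subseteq> data Y_ex \<union> ctrl Y_ex \<union> ((ctrl Y_ex \<union> data Y_ex) O co Y_ex)"
    using internal_subset[of Y_ex "co Y_ex"] internal_subset[of Y_ex "rf Y_ex"]
    by (fastforce simp: dob_def Y_ex_def)
  also have "\<dots> \<subseteq> {(x, y). rank x < rank y}"
    by (auto simp: Y_ex_def)
  finally show ?thesis .
qed

lemma aob_Y_ex_rank: "aob Y_ex \<subseteq> {(x, y). rank x < rank y}"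
  by (auto simp: aob_def internal_def Y_ex_def)

text \<open>Without fences, every edge leaves the acquire \<open>Ec 1\<close>, of least rank in
  \<open>Y_ex\<close>, or enters the release \<open>Ec 5\<close>, of greatest rank.\<close>

lemma bob_Y_ex_rank: "bob Y_ex \<subseteq> {(x, y). rank x < rank y}"
  by (auto simp: bob_def dmb_def dmbld_def dmbst_def internal_def Y_ex_def)

lemma ob_Y_ex_rank: "ob Y_ex \<subseteq> {(x, y). rank x < rank y}"
  unfolding ob_def tfence_Y_ex
  using dob_Y_ex_rank aob_Y_ex_rank bob_Y_ex_rank com_Y_ex_rank external_subset[of Y_ex "com Y_ex"]
  by blast

lemma stxn_Y_ex_rank: "stxn Y_ex \<subseteq> {(x, y). rank x = rank y}"
  by (auto simp: Y_ex_def)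

lemma RMWIsol_Y_ex: "RMWIsol Y_ex"
proof -
  have "(Ec 1, Ec 2) \<in> po Y_ex" "(Ec 1, Ec 5) \<in> po Y_ex"
    by (auto simp: Y_ex_def)
  \<comment> \<open>Both \<open>fr\<close> edges out of \<open>Ec 1\<close> stay within its thread,
    so the only \<open>rmw\<close> pair cannot be split.\<close>
  then have "(Ec 1, x) \<notin> external Y_ex (fr Y_ex)" for x
    by (auto simp: external_def fr_Y_ex)
  moreover have "rmw Y_ex = {(Ec 1, Ec 2)}"
    by (simp add: Y_ex_def)
  ultimately show ?thesis
    by (auto simp: RMWIsol_def)
qed

lemma arm_consistent_Y_ex: "arm_consistent Y_ex"
proof -
  \<comment> \<open>The rank fails to increase along \<open>po\<close> only at (\<open>Ec 2\<close>,
    \<open>Ec 3\<close>) and (\<open>Ed 1\<close>, \<open>Ed 2\<close>), and each of these pairs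
    spans two locations.\<close>
  have "po Y_ex \<inter> sloc Y_ex \<subseteq> {(x, y). rank x < rank y}"
    by (auto simp: Y_ex_def)
  then have "Coherence Y_ex"
    unfolding Coherence_def using com_Y_ex_rank by (intro acyclic_rank[where f = rank]) blast
  moreover have "Order Y_ex"
    unfolding Order_def by (rule acyclic_rank[OF ob_Y_ex_rank])
  moreover have "StrongIsol Y_ex" "TxnOrder Y_ex"
    unfolding StrongIsol_def TxnOrder_def
    using acyclic_stronglift_rank stxn_Y_ex_rank com_Y_ex_rank ob_Y_ex_rank by blast+
  moreover have "TxnCancelsRMW Y_ex"
    \<comment> \<open>The closure of the empty relation is the identity, and \<open>rmw\<close>
      links distinct events.\<close>
    unfolding TxnCancelsRMW_def tfence_Y_ex by (auto simp: Y_ex_def)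
  ultimately show ?thesis
    by (simp add: arm_consistent_def RMWIsol_Y_ex)
qed

section \<open>Well-formedness\<close>

lemma wf_arm_exec_Y_ex: "wf_arm_exec Y_ex"
proof -
  have "wf_structure Y_ex"
    unfolding wf_structure_def
    by (intro conjI; (auto simp: Y_ex_def irrefl_def trans_def total_on_def equiv_def refl_on_def
          sym_def single_valued_def)?)
  then show ?thesis
    by (auto simp: wf_arm_exec_def partitioned_into_def disjnt_def Y_ex_def)
qed

lemma matching_X_ex: "matching X_ex = {(Ea 1, Ea 4)}"
  and matching_t_X_ex: "matching_t X_ex = {(Eb 1, Eb 3)}"
  by (auto simp: matching_def matching_t_def adjacent_def lock_events_def X_ex_def)

lemma wf_lock_exec_X_ex: "wf_lock_exec X_ex"
proof -
  have "wf_structure X_ex"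
    unfolding wf_structure_def
    by (intro conjI; (auto simp: X_ex_def irrefl_def trans_def total_on_def equiv_def refl_on_def
          sym_def single_valued_def)?)
  moreover have "partitioned_into (events X_ex)
      [reads X_ex, writes X_ex, fences X_ex, Lk X_ex, Ul X_ex, Lt X_ex, Ut X_ex]"
    by (auto simp: partitioned_into_def disjnt_def X_ex_def)
  ultimately show ?thesis
    unfolding wf_lock_exec_def matching_X_ex matching_t_X_ex by (auto simp: X_ex_def)
qed

section \<open>Critical regions and the failure of \<open>CROrder\<close>\<close>

lemma region_X_ex:
  "region X_ex (Ea 1) (Ea 4) = {Ea 1, Ea 2, Ea 3, Ea 4}"
  "region X_ex (Eb 1) (Eb 3) = {Eb 1, Eb 2, Eb 3}"
  by (auto simp: region_def X_ex_def)

lemma scr_t_X_ex: "scr_t X_ex = {Eb 1, Eb 2, Eb 3} \<times> {Eb 1, Eb 2, Eb 3}"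
  by (simp add: scr_t_def matching_t_X_ex region_X_ex)

lemma scr_X_ex:
  "scr X_ex = {Ea 1, Ea 2, Ea 3, Ea 4} \<times> {Ea 1, Ea 2, Ea 3, Ea 4} \<union>
    {Eb 1, Eb 2, Eb 3} \<times> {Eb 1, Eb 2, Eb 3}"
  by (auto simp: scr_def matching_X_ex matching_t_X_ex region_X_ex)

lemma not_CROrder_X_ex: "\<not> CROrder X_ex"
proof
  let ?r = "weaklift (po X_ex \<union> com X_ex) (scr X_ex)"
  assume "CROrder X_ex"
  moreover have "(Ea 2, Eb 2) \<in> ?r"
    unfolding weaklift_def by (intro relcompI[where b = "Ea 2"] relcompI[where b = "Eb 2"])
      (auto simp: scr_X_ex com_X_ex)
  moreover have "(Eb 2, Ea 2) \<in> ?r"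
    \<comment> \<open>The \<open>co\<close> edge ends at \<open>Ea 3\<close>; the final
      \<open>scr\<close> step goes back to \<open>Ea 2\<close> in the same region and closes the
      cycle.\<close>
    unfolding weaklift_def by (intro relcompI[where b = "Eb 2"] relcompI[where b = "Ea 3"])
      (auto simp: scr_X_ex com_X_ex)
  ultimately show False
    unfolding CROrder_def acyclic_def by (meson trancl.intros)
qed

section \<open>The elision mapping\<close>

lemma po_X_ex:
  "po X_ex = {(Ea 1, Ea 2), (Ea 1, Ea 3), (Ea 1, Ea 4), (Ea 2, Ea 3), (Ea 2, Ea 4), (Ea 3, Ea 4),
    (Eb 1, Eb 2), (Eb 1, Eb 3), (Eb 2, Eb 3)}"
  by (simp add: X_ex_def insert_commute)

lemma lock_events_X_ex: "lock_events X_ex = {Ea 1, Ea 4, Eb 1, Eb 3}"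
  by (auto simp: lock_events_def X_ex_def)

lemma non_lock_events_X_ex: "events X_ex - lock_events X_ex = {Ea 2, Ea 3, Eb 2}"
  by (auto simp: lock_events_X_ex) (auto simp: X_ex_def)

lemma pi_ex_image:
  "pi_ex `` {Ea 1} = {Ec 1, Ec 2}" "pi_ex `` {Ea 2} = {Ec 3}" "pi_ex `` {Ea 3} = {Ec 4}"
  "pi_ex `` {Ea 4} = {Ec 5}" "pi_ex `` {Eb 1} = {Ed 1}" "pi_ex `` {Eb 2} = {Ed 2}"
  "pi_ex `` {Eb 3} = {}"
  by (auto simp: pi_ex_def)

lemma elision_events_ex: "elision_events X_ex Y_ex pi_ex"
proof -
  have "same_type X_ex Y_ex (Ea 2) (Ec 3)" "same_type X_ex Y_ex (Ea 3) (Ec 4)"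
    "same_type X_ex Y_ex (Eb 2) (Ed 2)"
    by (auto simp: same_type_def X_ex_def Y_ex_def)
  then have "\<forall>e \<in> events X_ex - lock_events X_ex.
      \<exists>f. pi_ex `` {e} = {f} \<and> same_type X_ex Y_ex e f"
    unfolding non_lock_events_X_ex by (auto simp: pi_ex_image)
  moreover have "\<exists>r w. pi_ex `` {Ea 1} = {r, w} \<and> r \<in> reads Y_ex \<inter> Acq Y_ex \<and> w \<in> writes Y_ex \<and>
      (r, w) \<in> rmw Y_ex \<and> (r, w) \<in> ctrl Y_ex"
    by (rule exI[of _ "Ec 1"], rule exI[of _ "Ec 2"]) (simp add: pi_ex_image Y_ex_def)
  moreover have "Lk X_ex = {Ea 1}" "Ul X_ex = {Ea 4}" "Lt X_ex = {Eb 1}" "Ut X_ex = {Eb 3}"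
    by (simp_all add: X_ex_def)
  ultimately show ?thesis
    unfolding elision_events_def by (simp add: pi_ex_image) (simp add: Y_ex_def)
qed

lemma elision_structure_ex: "elision_structure X_ex Y_ex pi_ex"
proof -
  have "\<forall>(e, e') \<in> po X_ex. \<forall>f f'. (e, f) \<in> pi_ex \<and> (e', f') \<in> pi_ex \<longrightarrow> (f, f') \<in> po Y_ex"
    by (simp add: po_X_ex) (simp add: Y_ex_def pi_ex_def)
  then show ?thesis
    unfolding elision_structure_def non_lock_events_X_ex Let_def preserves_reflects_on_def
    by (intro conjI) (simp_all add: X_ex_def Y_ex_def pi_ex_def)
qed

lemma elision_mapping_ex: "elision_mapping X_ex Y_ex pi_ex"
proof -
  have "pi_ex \<subseteq> events X_ex \<times> events Y_ex"
    by (auto simp: pi_ex_def X_ex_def Y_ex_def)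
  moreover have "\<forall>f \<in> events Y_ex. \<exists>!e. (e, f) \<in> pi_ex"
    by (simp add: pi_ex_def Y_ex_def)
  moreover have "LockVar X_ex Y_ex pi_ex"
  proof -
    have "pi_ex `` lock_events X_ex = {Ec 1, Ec 2, Ec 5, Ed 1}"
      by (subst Image_eq_UN) (auto simp: lock_events_X_ex pi_ex_image)
    moreover have "pi_ex^-1 O sloc X_ex O pi_ex = {Ec 3, Ec 4, Ed 2} \<times> {Ec 3, Ec 4, Ed 2}"
    proof -
      have "pi_ex `` {Ea 2, Ea 3, Eb 2} = {Ec 3, Ec 4, Ed 2}"
        by (subst Image_eq_UN) (auto simp: pi_ex_image)
      moreover have "sloc X_ex = {Ea 2, Ea 3, Eb 2} \<times> {Ea 2, Ea 3, Eb 2}"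
        unfolding X_ex_def arm_exec.select_convs ..
      ultimately show ?thesis
        by (simp only: relcomp_Times_Image)
    qed
    ultimately show ?thesis
      by (auto simp: LockVar_def Y_ex_def)
  qed
  moreover have "TxnIntro X_ex Y_ex pi_ex"
  proof -
    have "pi_ex^-1 `` {Ed 1, Ed 2} = {Eb 1, Eb 2}"
      by (auto simp: pi_ex_def)
    then have "pi_ex O stxn Y_ex O pi_ex^-1 = {Eb 1, Eb 2} \<times> {Eb 1, Eb 2}"
      using relcomp_Times_Image[of "pi_ex^-1" "{Ed 1, Ed 2}" "{Ed 1, Ed 2}" "pi_ex^-1"]
      by (simp add: Y_ex_def)
    moreover have "Ut X_ex = {Eb 3}"
      by (simp add: X_ex_def)
    \<comment> \<open>Removing the unlock \<open>Eb 3\<close>, which has no image, from its region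
      leaves exactly the preimage of the transaction.\<close>
    ultimately show ?thesis
      unfolding TxnIntro_def scr_t_X_ex by auto
  qed
  moreover have "TxnReadsLockFree X_ex Y_ex pi_ex"
    by (auto simp: TxnReadsLockFree_def Y_ex_def)
  ultimately show ?thesis
    by (simp add: elision_mapping_def elision_events_ex elision_structure_ex)
qed

theorem mainTheorem3:
  shows "(\<exists>(X :: event lock_exec) (Y :: event arm_exec) \<pi>.
            wf_lock_exec X \<and> wf_arm_exec Y \<and> elision_mapping X Y \<pi> \<and>
            \<not> CROrder X \<and> arm_consistent Y)
       \<and> wf_lock_exec X_ex \<and> wf_arm_exec Y_ex \<and> elision_mapping X_ex Y_ex pi_ex
       \<and> \<not> CROrder X_ex \<and> arm_consistent Y_ex"
  using wf_lock_exec_X_ex wf_arm_exec_Y_ex elision_mapping_ex not_CROrder_X_ex arm_consistent_Y_ex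
  by blast

end
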